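(* Let $d\ge 2$, $\rho\in[0,1)$ and $Q\in O(d)$, and let $(U,V)$ be a random vector on $S^{d-1}\times S^{d-1}$ with density $$c(u,v)=\frac{1}{A_{d-1}^2}\,\frac{1-\rho^2}{(1-2\rho\,u'Qv+\rho^2)^{d/2}},\qquad u,v\in S^{d-1}.$$ Then $E(U)=E(V)=0$, $E(UU')=E(VV')=d^{-1}I$ and $E(UV')=d^{-1}\rho Q$. Consequently the Johnson–Wehrly correlation coefficient satisfies $\rho_{JW}=\lambda^{1/2}=\rho$, where $\lambda$ is the largest eigenvalue of $\Sigma_{UU}^{-1}\Sigma_{UV}\Sigma_{VV}^{-1}\Sigma_{UV}'$ with $\Sigma_{UU}=E(UU')-E(U)E(U')$, $\Sigma_{UV}=E(UV')-E(U)E(V')$, $\Sigma_{VV}=E(VV')-E(V)E(V')$.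
   Context: $S^{d-1}=\{x\in\mathbb{R}^d:\|x\|=1\}$, $x'$ denotes transpose, $O(d)$ is the group of $d\times d$ orthogonal matrices, $I$ is the $d\times d$ identity matrix, and $A_{d-1}=2\pi^{d/2}/\Gamma(d/2)$ is the surface area of $S^{d-1}$. *)

theory Defs
  imports "HOL-Probability.Probability"
begin

text \<open>Surface (area) measure on the unit sphere of a Euclidean space, defined as the
cone measure: sigma(A) = d * Lebesgue measure of {t x | 0 < t <= 1, x in A}.
For the unit sphere this coincides with the (d-1)-dimensional Hausdorff measure;
its total mass is 2 pi^(d/2) / Gamma(d/2).\<close>
definition sphere_measure :: "('a::euclidean_space) measure" where
  "sphere_measure = measure_of (sphere 0 1) (sets (restrict_space borel (sphere 0 1)))
     (\<lambda>A. of_nat DIM('a) * emeasure lborel {t *\<^sub>R x | t x. t \<in> {0<..1} \<and> x \<in> A})"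

definition sphere_area :: "nat \<Rightarrow> real" where
  "sphere_area d = 2 * pi powr (real d / 2) / Gamma (real d / 2)"

definition jw_density :: "real \<Rightarrow> real^'n^'n \<Rightarrow> real^'n \<Rightarrow> real^'n \<Rightarrow> real" where
  "jw_density \<rho> Q u v =
     1 / (sphere_area CARD('n))\<^sup>2 * (1 - \<rho>\<^sup>2) /
       (1 - 2 * \<rho> * (u \<bullet> (Q *v v)) + \<rho>\<^sup>2) powr (real CARD('n) / 2)"

definition outer :: "real^'n \<Rightarrow> real^'m \<Rightarrow> real^'m^'n" where
  "outer u v = (\<chi> i j. u $ i * v $ j)"

definition largest_eigenvalue :: "real^'n^'n \<Rightarrow> real" where
  "largest_eigenvalue A = Max {c. \<exists>x. x \<noteq> 0 \<and> A *v x = c *\<^sub>R x}"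

definition cov_mat :: "'w measure \<Rightarrow> ('w \<Rightarrow> real^'n) \<Rightarrow> ('w \<Rightarrow> real^'m) \<Rightarrow> real^'m^'n" where
  "cov_mat M X Y = (\<integral>\<omega>. outer (X \<omega>) (Y \<omega>) \<partial>M) - outer (\<integral>\<omega>. X \<omega> \<partial>M) (\<integral>\<omega>. Y \<omega> \<partial>M)"

definition jw_corr :: "'w measure \<Rightarrow> ('w \<Rightarrow> real^'n) \<Rightarrow> ('w \<Rightarrow> real^'n) \<Rightarrow> real" where
  "jw_corr M U V = sqrt (largest_eigenvalue
     (matrix_inv (cov_mat M U U) ** cov_mat M U V ** matrix_inv (cov_mat M V V)
        ** transpose (cov_mat M U V)))"

end

theory Submission
  imports Defs
begin

text \<open>
Only the cross moment needs analysis. For fixed \<open>v\<close> put \<open>x = \<rho> Q v\<close>, so that the density in \<open>u\<close>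
is a constant times \<open>\<parallel>u - x\<parallel> ^ (- d)\<close>. Newton's shell theorem says that the attraction
\<open>\<integral> (u - x) / \<parallel>u - x\<parallel> ^ d \<partial>\<sigma>(u)\<close> vanishes inside the sphere, hence \<open>E(U V') = \<rho> Q E(V V')\<close>.

For the shell theorem, the radial substitution \<open>z \<mapsto> z / \<parallel>sgn z - x\<parallel>\<close> turns the attraction into the
integral of \<open>sgn y - x\<close> over the body \<open>{y. \<parallel>y - \<parallel>y\<parallel> x\<parallel> \<le> 1}\<close>. Let \<open>T\<close> be the involution that, on
directions, exchanges the two endpoints of each chord of the sphere through \<open>x\<close>: it is the Lorentz
reflection that fixes the timelike vector \<open>(1, x)\<close>, acting on the light cone \<open>{(\<parallel>y\<parallel>, y)}\<close>. It preserves
the body, has Jacobian \<open>\<parallel>T y\<parallel> / \<parallel>y\<parallel>\<close>, and reverses the sign of \<open>y - \<parallel>y\<parallel> x\<close>, so the integral equals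
its own negative.

The remaining moments are symmetry: the joint law is invariant under \<open>(u, v) \<mapsto> (R u, Q' R Q v)\<close> for
every orthogonal \<open>R\<close>.
\<close>

section \<open>Transport to a well-ordered index type\<close>

text \<open>The change-of-variables theorem of the library is stated only for index types of class
\<open>wellorder\<close>; an isometric copy of the index type supplies the order.\<close>

typedef 'a enumerated = "UNIV :: 'a set"
  morphisms from_enumerated to_enumerated
  by simp

lemma bij_from_enumerated: "bij from_enumerated"
  and bij_to_enumerated: "bij to_enumerated"
  by (metis bijI' from_enumerated_inject to_enumerated_inverse UNIV_I,
      metis bijI' from_enumerated_inverse to_enumerated_inverse UNIV_I)

instance enumerated :: (finite) finite
  by standard (metis bij_from_enumerated bij_betw_finite finite)

instantiation enumerated :: (finite) wellorder
begin

text \<open>The order is pulled back from the naturals along \<open>to_nat_on UNIV\<close>,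
  injective on a finite type; well-foundedness is then strong induction on that number.\<close>

definition less_eq_enumerated :: "'a enumerated \<Rightarrow> 'a enumerated \<Rightarrow> bool" where
  "x \<le> y \<longleftrightarrow> to_nat_on UNIV (from_enumerated x) \<le> to_nat_on UNIV (from_enumerated y)"

definition less_enumerated :: "'a enumerated \<Rightarrow> 'a enumerated \<Rightarrow> bool" where
  "x < y \<longleftrightarrow> to_nat_on UNIV (from_enumerated x) < to_nat_on UNIV (from_enumerated y)"

instance
proof
  fix P :: "'a enumerated \<Rightarrow> bool" and a
  assume step: "\<And>x. (\<And>y. y < x \<Longrightarrow> P y) \<Longrightarrow> P x"
  show "P a"
    by (induction a rule: measure_induct_rule[where f = "\<lambda>x. to_nat_on UNIV (from_enumerated x)"])
      (auto intro: step simp: less_enumerated_def)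
qed (auto simp: less_eq_enumerated_def less_enumerated_def from_enumerated_inject countable_finite)

end

definition enum_vec :: "real^'n \<Rightarrow> real^('n enumerated)" where
  "enum_vec x = (\<chi> k. x $ from_enumerated k)"

definition unenum_vec :: "real^('n enumerated) \<Rightarrow> real^'n" where
  "unenum_vec y = (\<chi> i. y $ to_enumerated i)"

lemma unenum_enum_vec [simp]: "unenum_vec (enum_vec x) = x"
  by (simp add: enum_vec_def unenum_vec_def to_enumerated_inverse)

lemma linear_enum_vec: "linear enum_vec"
  and linear_unenum_vec: "linear unenum_vec"
  by (auto intro!: linearI simp: enum_vec_def unenum_vec_def vec_eq_iff)

lemma inner_unenum_vec [simp]: "unenum_vec x \<bullet> unenum_vec y = x \<bullet> y"
  unfolding inner_vec_def unenum_vec_def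
  using sum.reindex_bij_betw[OF bij_to_enumerated, of "\<lambda>k. x $ k \<bullet> y $ k"] by simp

lemma inner_enum_vec [simp]: "enum_vec x \<bullet> enum_vec y = x \<bullet> y"
  by (metis inner_unenum_vec unenum_enum_vec)

lemma norm_unenum_vec [simp]: "norm (unenum_vec x) = norm x"
  and norm_enum_vec [simp]: "norm (enum_vec y) = norm y"
  by (simp_all add: norm_eq_sqrt_inner)

lemma card_enumerated [simp]: "CARD('n::finite enumerated) = CARD('n)"
  using bij_betw_same_card[OF bij_from_enumerated] .

lemma measurable_unenum_vec [measurable]: "unenum_vec \<in> borel_measurable borel"
  and measurable_enum_vec [measurable]: "enum_vec \<in> borel_measurable borel"
  by (rule borel_measurable_continuous_onI linear_continuous_on,
      simp add: linear_conv_bounded_linear[symmetric] linear_unenum_vec linear_enum_vec)+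

section \<open>Lebesgue measure under isometries\<close>

lemma emeasure_lborel_box_cart:
  fixes l u :: "real^'k::finite"
  assumes "\<And>i. l $ i \<le> u $ i"
  shows "emeasure lborel (box l u) = (\<Prod>i\<in>UNIV. ennreal (u $ i - l $ i))"
proof -
  have "emeasure lborel (box l u) = (\<Prod>b\<in>Basis. ennreal ((u - l) \<bullet> b))"
    using assms by (subst emeasure_lborel_box)
      (auto simp: Basis_vec_def inner_axis inner_diff_left intro!: prod_ennreal[symmetric])
  also have "\<dots> = (\<Prod>i\<in>UNIV. ennreal (u $ i - l $ i))"
    by (simp add: Basis_vec_def cart_eq_inner_axis axis_eq_axis prod.UNION_disjoint inner_diff_left)
  finally show ?thesis .
qed

text \<open>Lebesgue measure is determined by its values on boxes; renaming coordinates turns boxes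
  into boxes and merely reindexes the product of side lengths.\<close>

lemma distr_unenum_vec: "distr lborel borel unenum_vec = (lborel :: (real^'n) measure)"
proof (rule lborel_eqI[symmetric])
  fix l u :: "real^'n"
  assume le: "\<And>b. b \<in> Basis \<Longrightarrow> l \<bullet> b \<le> u \<bullet> b"
  then have le': "l $ i \<le> u $ i" for i
    using le[of "axis i 1"] by (auto simp: inner_axis Basis_vec_def)
  have "(unenum_vec -` box l u :: (real^('n enumerated)) set) = box (enum_vec l) (enum_vec u)"
    unfolding box_def unenum_vec_def enum_vec_def set_eq_iff
    by (auto simp: Basis_vec_def inner_axis)
      (metis from_enumerated_inverse to_enumerated_inverse UNIV_I)+
  then have "emeasure (distr lborel borel unenum_vec) (box l u)
      = emeasure lborel (box (enum_vec l) (enum_vec u))"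
    by (simp add: emeasure_distr)
  also have "\<dots> = (\<Prod>k\<in>UNIV. ennreal (u $ from_enumerated k - l $ from_enumerated k))"
    by (subst emeasure_lborel_box_cart) (auto simp: enum_vec_def le')
  also have "\<dots> = (\<Prod>i\<in>UNIV. ennreal (u $ i - l $ i))"
    by (rule prod.reindex_bij_betw[OF bij_from_enumerated])
  also have "\<dots> = emeasure lborel (box l u)"
    by (subst emeasure_lborel_box_cart) (auto simp: le')
  finally show "emeasure (distr lborel borel unenum_vec) (box l u) = ennreal (\<Prod>b\<in>Basis. (u - l) \<bullet> b)"
    using le by simp
qed simp

text \<open>The preimage of a box is its image under the inverse map, whose determinant has modulus
  1; agreement on boxes then identifies the measure.\<close>

lemma distr_orthogonal_wellorder:
  fixes f :: "real^'m::{finite,wellorder} \<Rightarrow> real^'m::_"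
  assumes f: "orthogonal_transformation f"
  shows "distr lborel borel f = lborel"
proof (rule lborel_eqI[symmetric])
  fix l u :: "real^'m::{finite,wellorder}"
  assume le: "\<And>b. b \<in> Basis \<Longrightarrow> l \<bullet> b \<le> u \<bullet> b"
  have [measurable]: "f \<in> borel_measurable borel"
    using f by (simp add: borel_measurable_continuous_onI linear_continuous_on linear_linear
        orthogonal_transformation_linear)
  have g: "orthogonal_transformation (inv f)" and bij: "bij f"
    using f by (simp_all add: orthogonal_transformation_inv orthogonal_transformation_bij)
  have lin: "linear (inv f)"
    using g by (simp add: orthogonal_transformation_linear)
  have eq: "f -` box l u = inv f ` box l u"
    using bij by (simp add: bij_vimage_eq_inv_image)
  have "emeasure (distr lborel borel f) (box l u) = emeasure lborel (inv f ` box l u)"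
    by (simp add: emeasure_distr eq)
  also have "\<dots> = emeasure lebesgue (inv f ` box l u)"
  proof -
    have "f -` box l u \<in> sets borel"
      by (rule measurable_sets_borel[OF \<open>f \<in> borel_measurable borel\<close>]) simp
    then show ?thesis
      by (simp add: eq)
  qed
  also have "\<dots> = measure lebesgue (inv f ` box l u)"
    using measurable_linear_image[OF lin, of "box l u"] by (simp add: emeasure_eq_measure2)
  also have "\<dots> = measure lebesgue (box l u)"
    using g by (subst measure_linear_image[OF lin]) auto
  also have "\<dots> = emeasure lborel (box l u)"
    by (simp add: emeasure_eq_measure2)
  finally show "emeasure (distr lborel borel f) (box l u) = ennreal (\<Prod>b\<in>Basis. (u - l) \<bullet> b)"
    using le by simp
qed simp

text \<open>Conjugating \<open>f\<close> with the isometry \<open>unenum_vec\<close> gives an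
  orthogonal map over the well-ordered index type; pushing forward along \<open>unenum_vec\<close>
  brings the invariance back.\<close>

lemma distr_lborel_orthogonal:
  fixes f :: "real^'n \<Rightarrow> real^'n"
  assumes f: "orthogonal_transformation f"
  shows "distr lborel borel f = lborel"
proof -
  have [measurable]: "f \<in> borel_measurable borel"
    using f by (simp add: borel_measurable_continuous_onI linear_continuous_on linear_linear
        orthogonal_transformation_linear)
  define h where "h = (\<lambda>x. enum_vec (f (unenum_vec x)))"
  have "orthogonal_transformation h"
    using f linear_compose[OF linear_compose[OF linear_unenum_vec] linear_enum_vec, of f]
    by (auto simp: orthogonal_transformation_def h_def o_def)
  then have "distr lborel borel h = lborel"
    by (rule distr_orthogonal_wellorder)
  then have "distr (distr lborel borel h) borel unenum_vec = (lborel :: (real^'n) measure)"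
    by (simp add: distr_unenum_vec)
  moreover have [measurable]: "h \<in> borel_measurable borel"
    unfolding h_def by measurable
  ultimately have "distr (distr lborel borel unenum_vec) borel f = (lborel :: (real^'n) measure)"
    by (simp add: distr_distr o_def h_def)
  then show ?thesis
    by (simp add: distr_unenum_vec)
qed

section \<open>The shell theorem\<close>

lemma norm_axis_eq: "norm (axis k c :: real^'n) = \<bar>c\<bar>"
  by (simp add: norm_eq_sqrt_inner inner_axis_axis)

text \<open>The matrix determinant lemma. Conjugation by an orthogonal map that sends
  \<open>a\<close> to a multiple of a coordinate axis confines the rank-one term to a single row,
  where Cramer's rule reads off the determinant.\<close>

lemma det_scaled_identity_plus_rank_one:
  fixes \<phi> :: "real^'n \<Rightarrow> real"
  assumes "linear \<phi>" and "s \<noteq> 0"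
  shows "det (matrix (\<lambda>h. s *\<^sub>R h + \<phi> h *\<^sub>R a)) = s ^ CARD('n) * (1 + \<phi> a / s)"
proof -
  define k :: 'n where "k = undefined"
  obtain P where P: "orthogonal_transformation P" "P a = axis k (norm a)"
    by (rule orthogonal_transformation_exists[of a "axis k (norm a)"]) (auto simp: norm_axis_eq)
  define G where "G = inv P"
  have G: "orthogonal_transformation G" and PG: "P (G y) = y" and GP: "G (P y) = y" for y
    using P orthogonal_transformation_inv[OF P(1)] orthogonal_transformation_bij[OF P(1)]
    by (auto simp: G_def bij_def surj_f_inv_f)
  note lin = orthogonal_transformation_linear[OF P(1)] orthogonal_transformation_linear[OF G]
  let ?L = "\<lambda>h. s *\<^sub>R h + \<phi> h *\<^sub>R a"
  have linL: "linear ?L"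
    using assms(1) by (auto intro!: linearI simp: linear_add linear_scale algebra_simps)
  have "matrix (P \<circ> ?L \<circ> G) = matrix P ** matrix ?L ** matrix G"
    using linL lin by (simp add: matrix_compose linear_compose)
  moreover have "matrix P ** matrix G = mat 1"
    using lin by (simp add: matrix_compose[symmetric] o_def PG matrix_id_mat_1 flip: id_def)
  then have "det (matrix P) * det (matrix G) = 1"
    by (metis det_mul det_I)
  ultimately have 1: "det (matrix ?L) = det (matrix (P \<circ> ?L \<circ> G))"
    by (simp add: det_mul)
  \<comment> \<open>The coefficients of row \<open>k\<close> of the conjugated matrix with respect
    to the rows of \<open>mat s\<close>; only \<open>x $ k\<close> survives in the
    determinant.\<close>
  define x :: "real^'n" where "x = (\<chi> j. (if j = k then 1 else 0) + norm a * \<phi> (G (axis j 1)) / s)"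
  have row: "row i (mat s :: real^'n^'n) = s *\<^sub>R axis i 1" for i
    by (auto simp: vec_eq_iff row_def mat_def axis_def)
  have "(P \<circ> ?L \<circ> G) y = s *\<^sub>R y + \<phi> (G y) *\<^sub>R axis k (norm a)" for y
    using lin by (simp add: linear_add linear_scale PG P(2))
  then have "matrix (P \<circ> ?L \<circ> G)
      = (\<chi> i. if i = k then \<Sum>j\<in>UNIV. x $ j *s row j (mat s) else row i (mat s))"
    using assms(2)
    by (auto simp: vec_eq_iff matrix_def row x_def axis_def if_distrib algebra_simps
        sum.delta cong: if_cong)
  then have "det (matrix (P \<circ> ?L \<circ> G)) = x $ k * det (mat s :: real^'n^'n)"
    by (simp add: cramer_lemma_transpose)
  moreover have "det (mat s :: real^'n^'n) = s ^ CARD('n)"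
    by (subst det_diagonal) (auto simp: mat_def)
  moreover have "norm a * \<phi> (G (axis k 1)) = \<phi> a"
  proof -
    have "\<phi> (G (P a)) = \<phi> (G (norm a *\<^sub>R axis k 1))"
      unfolding P(2) by (rule arg_cong[where f = "\<lambda>v. \<phi> (G v)"]) (auto simp: vec_eq_iff axis_def)
    then show ?thesis using lin assms(1) by (simp add: GP linear_scale)
  qed
  ultimately show ?thesis
    by (simp add: 1 x_def)
qed

section \<open>Radial substitution\<close>

lemma measurable_sgn_vector [measurable]:
  "(sgn :: 'a::euclidean_space \<Rightarrow> 'a) \<in> borel_measurable borel"
  unfolding sgn_div_norm[abs_def] by measurable

lemma punctured_ball_borel: "cball 0 1 - {0 :: 'a::euclidean_space} \<in> sets borel"
  by (intro sets.Diff) auto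

text \<open>Euler's identity in degree 0: \<open>r\<close> is constant along the ray through
  \<open>z\<close>, so its derivative in that direction vanishes.\<close>

lemma has_derivative_homogeneous_zero:
  fixes r :: "'a::real_normed_vector \<Rightarrow> real"
  assumes der: "(r has_derivative r') (at z)"
    and hom: "\<And>t. 0 < t \<Longrightarrow> r (t *\<^sub>R z) = r z"
  shows "r' z = 0"
proof -
  have "((\<lambda>t. t *\<^sub>R z) has_derivative (\<lambda>t. t *\<^sub>R z)) (at 1)"
    by (auto intro!: derivative_eq_intros)
  then have "((\<lambda>t. r (t *\<^sub>R z)) has_derivative (\<lambda>t. r' (t *\<^sub>R z))) (at 1)"
    using has_derivative_compose[of "\<lambda>t. t *\<^sub>R z" _ 1 UNIV r r'] der by simp
  moreover have "((\<lambda>t. r (t *\<^sub>R z)) has_derivative (\<lambda>t. 0)) (at 1)"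
    by (rule has_derivative_transform_within_open[of "\<lambda>_. r z" _ _ _ "{0<..}"]) (auto simp: hom)
  ultimately have "(\<lambda>t. r' (t *\<^sub>R z)) = (\<lambda>t. 0)"
    by (rule has_derivative_unique)
  then show ?thesis
    by (metis scaleR_one)
qed

text \<open>The derivative of the substitution is \<open>r z\<close> times the identity plus a
  rank-one term that, by Euler's identity, does not affect the determinant. The Jacobian is
  therefore exactly \<open>r z ^ CARD('m)\<close>, and the punctured ball becomes the punctured star
  body with radial function \<open>r\<close>.\<close>

lemma radial_change_of_variables:
  fixes r :: "real^'m::{finite,wellorder} \<Rightarrow> real" and f :: "real^'m::{finite,wellorder} \<Rightarrow> real^'n"
  assumes diff: "\<And>z. z \<noteq> 0 \<Longrightarrow> r differentiable (at z)"
    and pos: "\<And>z. z \<noteq> 0 \<Longrightarrow> 0 < r z"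
    and hom: "\<And>t z. 0 < t \<Longrightarrow> r (t *\<^sub>R z) = r z"
  shows "(\<lambda>z. r z ^ CARD('m) *\<^sub>R f (r z *\<^sub>R z)) absolutely_integrable_on (cball 0 1 - {0}) \<and>
      integral (cball 0 1 - {0}) (\<lambda>z. r z ^ CARD('m) *\<^sub>R f (r z *\<^sub>R z)) = b
    \<longleftrightarrow> f absolutely_integrable_on {y. y \<noteq> 0 \<and> norm y \<le> r y} \<and>
      integral {y. y \<noteq> 0 \<and> norm y \<le> r y} f = b"
proof -
  let ?D = "cball 0 1 - {0 :: real^'m::{finite,wellorder}}"
  define r' where "r' z = frechet_derivative r (at z)" for z
  have der: "(r has_derivative r' z) (at z)" if "z \<noteq> 0" for z
    using diff[OF that] by (simp add: r'_def flip: frechet_derivative_works)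
  have det: "det (matrix (\<lambda>h. r z *\<^sub>R h + r' z h *\<^sub>R z)) = r z ^ CARD('m)" if "z \<noteq> 0" for z
  proof -
    have "r' z z = 0"
      using der[OF that] hom by (rule has_derivative_homogeneous_zero)
    moreover have "r z \<noteq> 0"
      using pos[OF that] by simp
    ultimately show ?thesis
      using det_scaled_identity_plus_rank_one[OF has_derivative_linear[OF der[OF that]], of "r z" z]
      by simp
  qed
  have inj: "inj_on (\<lambda>z. r z *\<^sub>R z) ?D"
  proof (rule inj_onI)
    fix y z assume yz: "y \<in> ?D" "z \<in> ?D" "r y *\<^sub>R y = r z *\<^sub>R z"
    \<comment> \<open>\<open>r\<close> takes the same value at a point and at its image, so the
      scaling factor can be recovered from the image and divided out.\<close>
    then have "r (r y *\<^sub>R y) = r y" "r (r z *\<^sub>R z) = r z" "0 < r y"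
      using hom[OF pos[of y], of y] hom[OF pos[of z], of z] pos[of y] by auto
    then have "r y = r z"
      using yz(3) by metis
    with yz(3) \<open>0 < r y\<close> show "y = z"
      by simp
  qed
  have image: "(\<lambda>z. r z *\<^sub>R z) ` ?D = {y. y \<noteq> 0 \<and> norm y \<le> r y}"
  proof (intro equalityI subsetI)
    fix y assume "y \<in> (\<lambda>z. r z *\<^sub>R z) ` ?D"
    then obtain z where "y = r z *\<^sub>R z" "z \<in> ?D"
      by (rule imageE)
    then have z: "z \<noteq> 0" "norm z \<le> 1" "y = r z *\<^sub>R z"
      by auto
    with pos[of z] show "y \<in> {y. y \<noteq> 0 \<and> norm y \<le> r y}"
      by (simp add: hom mult_left_le)
  next
    fix y assume "y \<in> {y. y \<noteq> 0 \<and> norm y \<le> r y}"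
    then have y: "y \<noteq> 0" "norm y \<le> r y" "0 < r y"
      using pos by auto
    then have "r (inverse (r y) *\<^sub>R y) = r y"
      by (simp add: hom)
    with y show "y \<in> (\<lambda>z. r z *\<^sub>R z) ` ?D"
      by (intro image_eqI[of _ _ "inverse (r y) *\<^sub>R y"]) (auto simp: field_simps)
  qed
  have der_map: "((\<lambda>z. r z *\<^sub>R z) has_derivative (\<lambda>h. r z *\<^sub>R h + r' z h *\<^sub>R z)) (at z within ?D)"
    if "z \<in> ?D" for z
  proof (rule has_derivative_at_withinI)
    from that have "z \<noteq> 0"
      by simp
    then show "((\<lambda>z. r z *\<^sub>R z) has_derivative (\<lambda>h. r z *\<^sub>R h + r' z h *\<^sub>R z)) (at z)"
      by (rule has_derivative_scaleR[OF der has_derivative_ident])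
  qed
  have D: "?D \<in> sets lebesgue"
    using punctured_ball_borel by simp
  have cov: "(\<lambda>z. \<bar>det (matrix (\<lambda>h. r z *\<^sub>R h + r' z h *\<^sub>R z))\<bar> *\<^sub>R f (r z *\<^sub>R z))
        absolutely_integrable_on ?D \<and>
      integral ?D (\<lambda>z. \<bar>det (matrix (\<lambda>h. r z *\<^sub>R h + r' z h *\<^sub>R z))\<bar> *\<^sub>R f (r z *\<^sub>R z)) = b
    \<longleftrightarrow> f absolutely_integrable_on {y. y \<noteq> 0 \<and> norm y \<le> r y} \<and>
      integral {y. y \<noteq> 0 \<and> norm y \<le> r y} f = b"
    using has_absolute_integral_change_of_variables[OF D der_map inj, of f b] unfolding image .
  have eq: "\<bar>det (matrix (\<lambda>h. r z *\<^sub>R h + r' z h *\<^sub>R z))\<bar> *\<^sub>R f (r z *\<^sub>R z)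
      = r z ^ CARD('m) *\<^sub>R f (r z *\<^sub>R z)" if "z \<in> ?D" for z
    using det[of z] pos[of z] that by simp
  have "(\<lambda>z. \<bar>det (matrix (\<lambda>h. r z *\<^sub>R h + r' z h *\<^sub>R z))\<bar> *\<^sub>R f (r z *\<^sub>R z))
        absolutely_integrable_on ?D
      \<longleftrightarrow> (\<lambda>z. r z ^ CARD('m) *\<^sub>R f (r z *\<^sub>R z)) absolutely_integrable_on ?D"
    by (rule set_integrable_cong[OF refl refl eq])
  moreover have "integral ?D (\<lambda>z. \<bar>det (matrix (\<lambda>h. r z *\<^sub>R h + r' z h *\<^sub>R z))\<bar> *\<^sub>R f (r z *\<^sub>R z))
      = integral ?D (\<lambda>z. r z ^ CARD('m) *\<^sub>R f (r z *\<^sub>R z))"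
    by (rule Henstock_Kurzweil_Integration.integral_cong[OF eq])
  ultimately show ?thesis
    using cov by (simp only:)
qed

section \<open>The chord involution on the light cone\<close>

lemma inner_self_less_1: "norm x < 1 \<Longrightarrow> x \<bullet> x < 1"
  by (simp add: dot_square_norm power_less_one_iff abs_square_less_1)

text \<open>With the Lorentz product \<open>s * t - p \<bullet> q\<close> of \<open>(s, p)\<close>
  and \<open>(t, q)\<close>, the scalar is twice the product of \<open>(norm y, y)\<close> with
  \<open>(1, x)\<close>, divided by the product of \<open>(1, x)\<close> with itself. The result is
  the spatial part of the reflected vector.\<close>

definition chord_map :: "'a::real_inner \<Rightarrow> 'a \<Rightarrow> 'a" where
  "chord_map x y = (2 * (norm y - x \<bullet> y) / (1 - x \<bullet> x)) *\<^sub>R x - y"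

text \<open>The reflection preserves the Lorentz form, so the squared norm of the image is the
  square of its time component \<open>a - norm y\<close>. It remains to see that the image lies on
  the forward cone, that is, \<open>norm y \<le> a\<close>.\<close>

lemma norm_chord_map:
  assumes "norm x < 1"
  shows "norm (chord_map x y) = 2 * (norm y - x \<bullet> y) / (1 - x \<bullet> x) - norm y"
proof -
  define c a where "c = 1 - x \<bullet> x" and "a = 2 * (norm y - x \<bullet> y) / c"
  have c: "0 < c"
    using inner_self_less_1[OF assms] by (simp add: c_def)
  have ac: "a * (1 - x \<bullet> x) = 2 * (norm y - x \<bullet> y)"
    using c by (simp add: a_def c_def)
  \<comment> \<open>From \<open>2 * norm x \<le> 1 + x \<bullet> x\<close>; with Cauchy-Schwarz it
    gives \<open>c * norm y \<le> 2 * (norm y - x \<bullet> y)\<close>.\<close>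
  have "norm y * norm x * 2 \<le> norm y * (1 + x \<bullet> x)"
    using mult_left_mono[OF sum_squares_bound[of 1 "norm x"] norm_ge_zero[of y]]
    by (simp add: power2_norm_eq_inner algebra_simps)
  moreover have "x \<bullet> y \<le> norm x * norm y"
    by (rule norm_cauchy_schwarz)
  ultimately have "c * norm y \<le> c * a"
    using ac by (simp add: c_def algebra_simps)
  then have nonneg: "0 \<le> a - norm y"
    using c by simp
  have "(norm (chord_map x y))\<^sup>2 = a * (a * (x \<bullet> x)) - 2 * a * (x \<bullet> y) + (norm y)\<^sup>2"
    unfolding chord_map_def c_def[symmetric] a_def[symmetric]
    by (simp add: power2_norm_eq_inner inner_diff_left inner_diff_right inner_commute)
  also have "a * (x \<bullet> x) = a - 2 * (norm y - x \<bullet> y)"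
    using ac by (simp add: algebra_simps)
  also have "a * (a - 2 * (norm y - x \<bullet> y)) - 2 * a * (x \<bullet> y) + (norm y)\<^sup>2 = (a - norm y)\<^sup>2"
    by (simp add: power2_eq_square algebra_simps)
  finally have "norm (chord_map x y) = a - norm y"
    using nonneg by (simp add: power2_eq_iff_nonneg)
  then show ?thesis
    by (simp add: a_def c_def)
qed

text \<open>Reflecting negates \<open>(norm y, y)\<close> and adds a multiple of
  \<open>(1, x)\<close>; the combination \<open>y - norm y *\<^sub>R x\<close> is blind to such
  multiples and only changes sign. For \<open>y \<noteq> 0\<close> the third identity is the power
  of the point \<open>x\<close>: its distances to the chord ends \<open>sgn y\<close> and
  \<open>sgn (chord_map x y)\<close> have product \<open>1 - x \<bullet> x\<close>.\<close>

lemma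
  assumes "norm x < 1"
  shows chord_map_chord_map: "chord_map x (chord_map x y) = y"
    and chord_map_diff: "chord_map x y - norm (chord_map x y) *\<^sub>R x = - (y - norm y *\<^sub>R x)"
    and norm_chord_map_mult:
      "norm y * norm (chord_map x y) * (1 - x \<bullet> x) = (norm (y - norm y *\<^sub>R x))\<^sup>2"
proof -
  define c a where "c = 1 - x \<bullet> x" and "a = 2 * (norm y - x \<bullet> y) / c"
  have c: "0 < c"
    using inner_self_less_1[OF assms] by (simp add: c_def)
  have ac: "a * (1 - x \<bullet> x) = 2 * (norm y - x \<bullet> y)"
    using c by (simp add: a_def c_def)
  have n: "norm (chord_map x y) = a - norm y"
    using norm_chord_map[OF assms] by (simp add: a_def c_def)
  have T: "chord_map x y = a *\<^sub>R x - y"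
    by (simp add: chord_map_def a_def c_def)
  \<comment> \<open>The Lorentz product with the fixed vector \<open>(1, x)\<close> is invariant, so
    a second application uses the same coefficient \<open>a\<close>.\<close>
  have "norm (chord_map x y) - x \<bullet> chord_map x y = norm y - x \<bullet> y"
    unfolding n unfolding T using ac by (simp add: inner_diff_right algebra_simps)
  then have "chord_map x (chord_map x y) = a *\<^sub>R x - chord_map x y"
    by (simp add: chord_map_def[of x "chord_map x y"] a_def c_def)
  then show "chord_map x (chord_map x y) = y"
    by (simp add: T)
  show "chord_map x y - norm (chord_map x y) *\<^sub>R x = - (y - norm y *\<^sub>R x)"
    unfolding n by (simp add: T algebra_simps)
  have "(norm (y - norm y *\<^sub>R x))\<^sup>2 = y \<bullet> y - 2 * norm y * (x \<bullet> y) + norm y * norm y * (x \<bullet> x)"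
    unfolding power2_norm_eq_inner
    by (simp add: inner_diff_left inner_diff_right inner_commute[of y x] algebra_simps)
  also have "\<dots> = norm y * (norm y * (1 + x \<bullet> x) - 2 * (x \<bullet> y))"
    by (simp add: dot_square_norm[of y] power2_eq_square algebra_simps)
  also have "norm y * (1 + x \<bullet> x) - 2 * (x \<bullet> y) = (a - norm y) * (1 - x \<bullet> x)"
    using ac by (simp add: algebra_simps)
  finally show "norm y * norm (chord_map x y) * (1 - x \<bullet> x) = (norm (y - norm y *\<^sub>R x))\<^sup>2"
    by (simp add: n)
qed

text \<open>The derivative is arranged as minus the identity plus a rank-one map, ready for the
  determinant lemma with \<open>s = -1\<close>.\<close>

lemma chord_map_has_derivative:
  assumes "y \<noteq> 0"
  shows "(chord_map x has_derivative
      (\<lambda>h. (-1) *\<^sub>R h + (2 * ((sgn y - x) \<bullet> h) / (1 - x \<bullet> x)) *\<^sub>R x)) (at y)"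
proof -
  have "((\<lambda>y. (2 * (norm y - x \<bullet> y) * inverse (1 - x \<bullet> x)) *\<^sub>R x - y) has_derivative
      (\<lambda>h. (2 * (h \<bullet> sgn y - x \<bullet> h) * inverse (1 - x \<bullet> x)) *\<^sub>R x - h)) (at y)"
    by (intro has_derivative_diff has_derivative_scaleR_left has_derivative_mult_left
        has_derivative_mult_right has_derivative_inner_right has_derivative_ident
        has_derivative_norm[OF assms])
  moreover have "(\<lambda>h. (2 * (h \<bullet> sgn y - x \<bullet> h) * inverse (1 - x \<bullet> x)) *\<^sub>R x - h)
      = (\<lambda>h. (-1) *\<^sub>R h + (2 * ((sgn y - x) \<bullet> h) / (1 - x \<bullet> x)) *\<^sub>R x)"
    by (rule ext) (simp add: divide_inverse inner_diff_left inner_commute[of "sgn y"])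
  ultimately show ?thesis
    by (simp only: chord_map_def[abs_def] divide_inverse)
qed

lemma abs_det_chord_map:
  fixes x y :: "real^'n"
  assumes "norm x < 1" "y \<noteq> 0"
  shows "\<bar>det (matrix (\<lambda>h. (-1) *\<^sub>R h + (2 * ((sgn y - x) \<bullet> h) / (1 - x \<bullet> x)) *\<^sub>R x))\<bar>
    = norm (chord_map x y) / norm y"
proof -
  have c: "x \<bullet> x < 1"
    by (rule inner_self_less_1[OF assms(1)])
  have lin: "linear (\<lambda>h. 2 * ((sgn y - x) \<bullet> h) / (1 - x \<bullet> x))"
    by (intro linearI) (simp_all add: inner_add_right add_divide_distrib distrib_left)
  have "(sgn y - x) \<bullet> x = x \<bullet> y / norm y - x \<bullet> x"
    by (simp add: sgn_div_norm inner_diff_left inner_commute[of y] divide_inverse mult.commute)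
  \<comment> \<open>A rational identity in \<open>norm y\<close>, \<open>x \<bullet> y\<close> and
    \<open>x \<bullet> x\<close>; writing \<open>c = 1 - q\<close> turns the denominator into a
    positive variable.\<close>
  moreover have key: "1 - 2 * (p / n - q) / (1 - q) = (2 * (n - p) / (1 - q) - n) / n"
    if "0 < n" "q < 1" for n p q :: real
  proof -
    have "1 - 2 * (p / n - (1 - c)) / c = (2 * (n - p) / c - n) / n" if "0 < c" for c
      using that \<open>0 < n\<close> by (simp add: field_simps)
    from this[of "1 - q"] show ?thesis
      using \<open>q < 1\<close> by simp
  qed
  ultimately have e: "1 - 2 * ((sgn y - x) \<bullet> x) / (1 - x \<bullet> x) = norm (chord_map x y) / norm y"
    using key[of "norm y" "x \<bullet> x" "x \<bullet> y"] c assms by (simp add: norm_chord_map)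
  have "\<bar>det (matrix (\<lambda>h. (-1) *\<^sub>R h + (2 * ((sgn y - x) \<bullet> h) / (1 - x \<bullet> x)) *\<^sub>R x))\<bar>
      = \<bar>1 + 2 * ((sgn y - x) \<bullet> x) / (1 - x \<bullet> x) / (-1)\<bar>"
    by (subst det_scaled_identity_plus_rank_one[OF lin]) (simp_all add: abs_mult power_abs)
  also have "\<dots> = \<bar>norm (chord_map x y) / norm y\<bar>"
    by (simp only: div_by_1 minus_divide_right[symmetric] add_uminus_conv_diff e)
  finally show ?thesis
    by simp
qed

lemma integral_cone_section_eq_0:
  fixes x :: "real^'m::{finite,wellorder}"
  assumes x: "norm x < 1"
    and int: "(\<lambda>y. sgn y - x) absolutely_integrable_on {y. y \<noteq> 0 \<and> norm (y - norm y *\<^sub>R x) \<le> 1}"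
  shows "integral {y. y \<noteq> 0 \<and> norm (y - norm y *\<^sub>R x) \<le> 1} (\<lambda>y. sgn y - x) = 0"
proof -
  let ?S = "{y :: real^'m::{finite,wellorder}. y \<noteq> 0 \<and> norm (y - norm y *\<^sub>R x) \<le> 1}"
  let ?T' = "\<lambda>y h. (-1) *\<^sub>R h + (2 * ((sgn y - x) \<bullet> h) / (1 - x \<bullet> x)) *\<^sub>R x"
  have T0: "chord_map x y = 0 \<longleftrightarrow> y = 0" for y
    using chord_map_chord_map[OF x, of y] by (auto simp: chord_map_def)
  \<comment> \<open>Apart from \<open>y \<noteq> 0\<close>, membership depends only on the norm of
    \<open>y - norm y *\<^sub>R x\<close>, which the involution negates.\<close>
  have mem: "chord_map x y \<in> ?S \<longleftrightarrow> y \<in> ?S" for y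
    by (simp add: T0 chord_map_diff[OF x] del: minus_diff_eq)
  have image: "chord_map x ` ?S = ?S"
  proof (intro equalityI subsetI)
    fix y assume "y \<in> ?S"
    then have "chord_map x y \<in> ?S"
      using mem by blast
    then show "y \<in> chord_map x ` ?S"
      by (intro image_eqI[of _ _ "chord_map x y"]) (simp_all only: chord_map_chord_map[OF x])
  next
    fix y assume "y \<in> chord_map x ` ?S"
    then obtain z where "z \<in> ?S" "y = chord_map x z"
      by (rule imageE)
    then show "y \<in> ?S"
      by (simp only: mem)
  qed
  have "{y \<in> space borel. y \<noteq> 0 \<and> norm (y - norm y *\<^sub>R x) \<le> 1} \<in> sets borel"
    by measurable
  then have "?S \<in> sets lebesgue"
    by auto
  moreover have "inj_on (chord_map x) ?S"
    by (rule inj_on_inverseI[of _ "chord_map x"]) (rule chord_map_chord_map[OF x])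
  moreover have "(chord_map x has_derivative ?T' y) (at y within ?S)" if "y \<in> ?S" for y
    using chord_map_has_derivative[of y x] that by (auto intro: has_derivative_at_withinI)
  ultimately have "integral ?S (\<lambda>y. sgn y - x)
      = integral ?S (\<lambda>y. \<bar>det (matrix (?T' y))\<bar> *\<^sub>R (sgn (chord_map x y) - x))"
    using integral_change_of_variables[of ?S "chord_map x" ?T' "\<lambda>y. sgn y - x"] int image by simp
  also have "\<dots> = integral ?S (\<lambda>y. - (sgn y - x))"
  proof (rule Henstock_Kurzweil_Integration.integral_cong)
    fix y assume "y \<in> ?S"
    then have y: "y \<noteq> 0" "chord_map x y \<noteq> 0"
      by (auto simp: T0)
    \<comment> \<open>The Jacobian exchanges the normalisation by
      \<open>norm (chord_map x y)\<close> for one by \<open>norm y\<close>, after which the sign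
      reversal applies.\<close>
    have "(norm (chord_map x y) / norm y) *\<^sub>R (sgn (chord_map x y) - x)
        = (1 / norm y) *\<^sub>R (chord_map x y - norm (chord_map x y) *\<^sub>R x)"
      using y by (simp add: sgn_div_norm scaleR_diff_right)
    also have "\<dots> = - (sgn y - x)"
      unfolding chord_map_diff[OF x] using y by (simp add: sgn_div_norm scaleR_diff_right divide_inverse)
    finally show "\<bar>det (matrix (?T' y))\<bar> *\<^sub>R (sgn (chord_map x y) - x) = - (sgn y - x)"
      by (simp only: abs_det_chord_map[OF x y(1)])
  qed
  also have "\<dots> = - integral ?S (\<lambda>y. sgn y - x)"
    by (rule Henstock_Kurzweil_Integration.integral_neg)
  finally show ?thesis
    by (simp add: eq_neg_iff_add_eq_0 flip: scaleR_2)
qed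

section \<open>The attraction integral over the ball\<close>

lemma norm_sgn_diff_ge: "z \<noteq> 0 \<Longrightarrow> 1 - norm x \<le> norm (sgn z - x)"
  using norm_triangle_ineq2[of "sgn z" x] by (simp add: norm_sgn)

text \<open>With \<open>r z\<close> the inverse distance from \<open>sgn z\<close> to
  \<open>x\<close>, the integrand is \<open>r z ^ CARD('m)\<close> times \<open>sgn z - x\<close>,
  the shape produced by the radial substitution; the transformed integral vanishes by the chord
  involution.\<close>

lemma has_bochner_integral_shell_ball_wellorder:
  fixes x :: "real^'m::{finite,wellorder}"
  assumes x: "norm x < 1"
  shows "has_bochner_integral lborel (\<lambda>z. indicator (cball 0 1 - {0}) z *\<^sub>R
      (inverse (norm (sgn z - x)) ^ CARD('m) *\<^sub>R (sgn z - x))) 0"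
proof -
  let ?D = "cball 0 1 - {0 :: real^'m::{finite,wellorder}}"
  define r where "r z = inverse (norm (sgn z - x))" for z
  have ge: "1 - norm x \<le> norm (sgn z - x)" if "z \<noteq> 0" for z
    using norm_sgn_diff_ge[OF that] .
  have pos: "0 < r z" if "z \<noteq> 0" for z
    using ge[OF that] x by (auto simp: r_def)
  have hom: "r (t *\<^sub>R z) = r z" if "0 < t" for t z
    using that by (simp add: r_def sgn_scaleR)
  have diff: "r differentiable (at z)" if "z \<noteq> 0" for z
  proof -
    have "(\<lambda>z. inverse (norm z) *\<^sub>R z - x) differentiable (at z)"
      using that by (intro derivative_intros) auto
    moreover have "sgn z - x \<noteq> 0"
      using ge[OF that] x by auto
    ultimately have "(\<lambda>z. norm (inverse (norm z) *\<^sub>R z - x)) differentiable (at z)"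
      using differentiable_compose[of norm "\<lambda>z. inverse (norm z) *\<^sub>R z - x" z UNIV]
      by (simp add: sgn_div_norm)
    then show ?thesis
      using \<open>sgn z - x \<noteq> 0\<close> unfolding r_def
      by (intro differentiable_inverse) (simp_all add: sgn_div_norm)
  qed
  \<comment> \<open>Multiplying the distance from \<open>sgn y\<close> to \<open>x\<close> by
    \<open>norm y\<close> identifies the star body of \<open>r\<close> with the set invariant under
    the chord map.\<close>
  have S: "{y. y \<noteq> 0 \<and> norm y \<le> r y} = {y. y \<noteq> 0 \<and> norm (y - norm y *\<^sub>R x) \<le> 1}"
  proof (intro Collect_cong conj_cong refl)
    fix y :: "real^'m::{finite,wellorder}" assume y: "y \<noteq> 0"
    have "norm y * norm (sgn y - x) = norm (norm y *\<^sub>R (sgn y - x))"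
      by simp
    also have "norm y *\<^sub>R (sgn y - x) = y - norm y *\<^sub>R x"
      using y by (simp add: scaleR_diff_right sgn_div_norm)
    finally show "norm y \<le> r y \<longleftrightarrow> norm (y - norm y *\<^sub>R x) \<le> 1"
      using pos[OF y] by (simp add: r_def field_simps)
  qed
  let ?F = "\<lambda>z. r z ^ CARD('m) *\<^sub>R (sgn z - x)"
  note [measurable] = punctured_ball_borel
  have [measurable]: "r \<in> borel_measurable borel"
    unfolding r_def by measurable
  have int: "integrable lborel (\<lambda>z. indicator ?D z *\<^sub>R ?F z)"
  \<comment> \<open>The bound combines \<open>r z \<le> inverse (1 - norm x)\<close> with
    \<open>norm (sgn z - x) \<le> 2\<close>.\<close>
  proof (rule integrableI_bounded_set[where A = ?D and B = "inverse (1 - norm x) ^ CARD('m) * 2"])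
    have "emeasure lborel ?D \<le> emeasure lborel (cball 0 1 :: (real^'m::{finite,wellorder}) set)"
      by (rule emeasure_mono) auto
    then show "emeasure lborel ?D < \<infinity>"
      using emeasure_lborel_cball_finite by (metis le_less_trans)
    show "AE z in lborel. z \<in> ?D \<longrightarrow>
        norm (indicator ?D z *\<^sub>R ?F z) \<le> inverse (1 - norm x) ^ CARD('m) * 2"
    proof (rule AE_I2, rule impI)
      fix z assume z: "z \<in> ?D"
      have "r z \<le> inverse (1 - norm x)"
        using ge[of z] z x by (auto simp: r_def intro: le_imp_inverse_le)
      moreover have "norm (sgn z - x) \<le> 2"
        using norm_triangle_ineq4[of "sgn z" x] x z by (simp add: norm_sgn)
      ultimately show "norm (indicator ?D z *\<^sub>R ?F z) \<le> inverse (1 - norm x) ^ CARD('m) * 2"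
        using z pos[of z] x by (auto intro!: mult_mono power_mono)
    qed
  qed auto
  \<comment> \<open>Both \<open>r\<close> and \<open>sgn\<close> see only the direction, which the
    substitution keeps.\<close>
  have sphere: "r (r z *\<^sub>R z) = r z \<and> sgn (r z *\<^sub>R z) = sgn z" if "z \<in> ?D" for z
    using that pos[of z] by (auto simp: hom sgn_scaleR)
  have "?F absolutely_integrable_on ?D"
    using int unfolding set_integrable_def by (subst integrable_completion) auto
  then have "(\<lambda>z. r z ^ CARD('m) *\<^sub>R (sgn (r z *\<^sub>R z) - x)) absolutely_integrable_on ?D"
    by (rule set_integrable_cong[OF refl refl, THEN iffD1, rotated]) (simp add: sphere)
  then have "(\<lambda>y. sgn y - x) absolutely_integrable_on {y. y \<noteq> 0 \<and> norm y \<le> r y} \<and>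
      integral {y. y \<noteq> 0 \<and> norm y \<le> r y} (\<lambda>y. sgn y - x)
      = integral ?D (\<lambda>z. r z ^ CARD('m) *\<^sub>R (sgn (r z *\<^sub>R z) - x))"
    by (intro radial_change_of_variables[THEN iffD1] conjI refl diff pos hom)
  then have "integral ?D (\<lambda>z. r z ^ CARD('m) *\<^sub>R (sgn (r z *\<^sub>R z) - x)) = 0"
    unfolding S using integral_cone_section_eq_0[OF x] by metis
  moreover have "integral ?D (\<lambda>z. r z ^ CARD('m) *\<^sub>R (sgn (r z *\<^sub>R z) - x)) = integral ?D ?F"
    by (rule Henstock_Kurzweil_Integration.integral_cong) (simp add: sphere)
  moreover have "(LINT z:?D|lborel. ?F z) = integral ?D ?F"
    by (rule set_borel_integral_eq_integral(2)) (use int in \<open>simp add: set_integrable_def\<close>)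
  ultimately show ?thesis
    using int by (simp add: has_bochner_integral_iff set_lebesgue_integral_def r_def)
qed

text \<open>The isometry \<open>unenum_vec\<close> commutes with \<open>sgn\<close> and preserves
  Lebesgue measure, so it carries the result to an arbitrary finite index type.\<close>

lemma has_bochner_integral_shell_ball:
  fixes x :: "real^'n"
  assumes x: "norm x < 1"
  shows "has_bochner_integral lborel (\<lambda>z. indicator (cball 0 1 - {0}) z *\<^sub>R
      (inverse (norm (sgn z - x)) ^ CARD('n) *\<^sub>R (sgn z - x))) 0"
proof -
  let ?F = "\<lambda>z. indicator (cball 0 1 - {0}) z *\<^sub>R
      (inverse (norm (sgn z - x)) ^ CARD('n) *\<^sub>R (sgn z - x))"
  note [measurable] = punctured_ball_borel
  have meas: "?F \<in> borel_measurable borel"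
    by measurable
  have bl: "bounded_linear (unenum_vec :: real^('n enumerated) \<Rightarrow> real^'n)"
    using linear_unenum_vec linear_conv_bounded_linear by blast
  have diff: "sgn (unenum_vec z) - x = unenum_vec (sgn z - enum_vec x)" for z
    by (simp add: linear_diff[OF linear_unenum_vec] linear_scale[OF linear_unenum_vec] sgn_div_norm)
  have zero: "unenum_vec z = 0 \<longleftrightarrow> z = 0" for z :: "real^('n enumerated)"
    by (metis norm_eq_zero norm_unenum_vec)
  have "?F (unenum_vec z) = unenum_vec (indicator (cball 0 1 - {0}) z *\<^sub>R
      (inverse (norm (sgn z - enum_vec x)) ^ CARD('n enumerated) *\<^sub>R (sgn z - enum_vec x)))" for z
    unfolding diff
    by (simp add: linear_scale[OF linear_unenum_vec] zero split: split_indicator)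
  moreover have "has_bochner_integral lborel (\<lambda>z. unenum_vec (indicator (cball 0 1 - {0}) z *\<^sub>R
      (inverse (norm (sgn z - enum_vec x)) ^ CARD('n enumerated) *\<^sub>R (sgn z - enum_vec x))))
      (unenum_vec 0)"
    by (intro has_bochner_integral_bounded_linear[OF bl] has_bochner_integral_shell_ball_wellorder)
      (use x in simp)
  ultimately have "has_bochner_integral lborel (\<lambda>z. ?F (unenum_vec z)) (unenum_vec 0)"
    by simp
  then have "has_bochner_integral (distr lborel borel unenum_vec) ?F (unenum_vec 0)"
    by (intro has_bochner_integral_distr[OF meas]) simp_all
  then show ?thesis
    by (simp only: distr_unenum_vec linear_0[OF linear_unenum_vec])
qed

section \<open>Surface measure\<close>

abbreviation sphere_borel :: "('a::euclidean_space) measure" where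
  "sphere_borel \<equiv> restrict_space borel (sphere 0 1)"

lemma sgn_measurable_punctured_ball:
  "sgn \<in> measurable (restrict_space lborel (cball 0 1 - {0})) (sphere_borel :: 'a::euclidean_space measure)"
  by (rule measurable_restrict_space3)
    (auto simp: norm_sgn dist_norm measurable_lborel1 intro: measurable_sgn_vector)

text \<open>Polar decomposition \<open>y = norm y *\<^sub>R sgn y\<close>; it exhibits the cone
  measure as a push-forward under \<open>sgn\<close>.\<close>

lemma cone_eq_sgn_vimage:
  fixes A :: "'a::euclidean_space set"
  assumes "A \<subseteq> sphere 0 1"
  shows "{t *\<^sub>R x | t x. t \<in> {0<..1} \<and> x \<in> A} = sgn -` A \<inter> (cball 0 1 - {0})"
proof (intro equalityI subsetI)
  fix y assume "y \<in> {t *\<^sub>R x | t x. t \<in> {0<..1} \<and> x \<in> A}"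
  then obtain t x where y: "y = t *\<^sub>R x" "0 < t" "t \<le> 1" "x \<in> A"
    by auto
  moreover have "norm x = 1"
    using y assms by auto
  ultimately show "y \<in> sgn -` A \<inter> (cball 0 1 - {0})"
    by (auto simp: sgn_scaleR sgn_div_norm)
next
  fix y assume "y \<in> sgn -` A \<inter> (cball 0 1 - {0})"
  then have "norm y \<in> {0<..1}" "sgn y \<in> A" "y = norm y *\<^sub>R sgn y"
    by (auto simp: sgn_div_norm)
  then show "y \<in> {t *\<^sub>R x | t x. t \<in> {0<..1} \<and> x \<in> A}"
    by blast
qed

text \<open>A set function given to \<open>measure_of\<close> takes effect only if it is countably
  additive. Agreement with a genuine measure supplies this, and makes the rules for
  \<open>density\<close> and \<open>distr\<close> available.\<close>

lemma sphere_measure_eq_density_distr: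
  "(sphere_measure :: 'a::euclidean_space measure) =
    density (distr (restrict_space lborel (cball 0 1 - {0})) sphere_borel sgn) (\<lambda>_. ennreal DIM('a))"
    (is "_ = ?N")
proof -
  have sets: "sets ?N = sets sphere_borel" and space: "space ?N = sphere 0 1"
    by (simp_all add: space_restrict_space)
  have "of_nat DIM('a) * emeasure lborel {t *\<^sub>R x | t x. t \<in> {0<..1} \<and> x \<in> A} = emeasure ?N A"
    if "A \<in> sets sphere_borel" for A :: "'a set"
  proof -
    have "A \<subseteq> sphere 0 1"
      using sets.sets_into_space[OF that] by (simp add: space_restrict_space)
    moreover have "sgn -` A \<inter> space (restrict_space lborel (cball 0 1 - {0})) \<subseteq> cball 0 1 - {0}"
      by (simp add: space_restrict_space)
    ultimately show ?thesis
      using that unfolding cone_eq_sgn_vimage[OF \<open>A \<subseteq> sphere 0 1\<close>]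
      by (simp add: emeasure_density_const emeasure_distr[OF sgn_measurable_punctured_ball]
          emeasure_restrict_space punctured_ball_borel space_restrict_space
          ennreal_of_nat_eq_real_of_nat)
  qed
  moreover have "sigma_sets (sphere 0 1) (sets sphere_borel) = sets (sphere_borel :: 'a measure)"
    using sets.sigma_sets_eq[of "sphere_borel :: 'a measure"] by (simp add: space_restrict_space)
  moreover have "sets sphere_borel \<subseteq> Pow (sphere 0 1 :: 'a set)"
    using sets.space_closed[of "sphere_borel :: 'a measure"] by (simp add: space_restrict_space)
  ultimately have "(sphere_measure :: 'a measure)
      = measure_of (sphere 0 1) (sets sphere_borel) (emeasure ?N)"
    unfolding sphere_measure_def by (intro measure_of_eq) auto
  also have "\<dots> = ?N"
    using measure_of_of_measure[of ?N] by (simp only: sets space)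
  finally show ?thesis .
qed

lemma space_sphere_measure [simp]: "space sphere_measure = sphere 0 1"
  and sets_sphere_measure [simp, measurable_cong]: "sets sphere_measure = sets sphere_borel"
  by (simp_all add: sphere_measure_eq_density_distr space_restrict_space)

lemma emeasure_sphere_measure:
  fixes A :: "'a::euclidean_space set"
  assumes "A \<in> sets sphere_borel"
  shows "emeasure sphere_measure A = ennreal DIM('a) * emeasure lborel (sgn -` A \<inter> (cball 0 1 - {0}))"
  using assms
  by (simp add: sphere_measure_eq_density_distr emeasure_density_const
      emeasure_distr[OF sgn_measurable_punctured_ball] emeasure_restrict_space punctured_ball_borel
      space_restrict_space)

lemma finite_sphere_measure: "finite_measure (sphere_measure :: 'a::euclidean_space measure)"
proof
  have "emeasure lborel (sgn -` sphere 0 1 \<inter> (cball 0 1 - {0 :: 'a})) \<le> emeasure lborel (cball 0 1 :: 'a set)"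
    by (rule emeasure_mono) auto
  then have "emeasure lborel (sgn -` sphere 0 1 \<inter> (cball 0 1 - {0 :: 'a})) < \<infinity>"
    using emeasure_lborel_cball_finite by (metis le_less_trans)
  moreover have "sphere 0 1 \<in> sets (sphere_borel :: 'a measure)"
    using sets.top[of "sphere_borel :: 'a measure"] by (simp add: space_restrict_space)
  ultimately show "emeasure sphere_measure (space (sphere_measure :: 'a measure)) \<noteq> \<infinity>"
    by (simp add: emeasure_sphere_measure ennreal_mult_eq_top_iff)
qed

text \<open>Turns surface integrals into volume integrals of radially constant extensions, where
  change of variables applies.\<close>

lemma has_bochner_integral_sphere_measure:
  fixes f :: "'a::euclidean_space \<Rightarrow> 'b::{banach, second_countable_topology}"
  assumes f: "f \<in> borel_measurable sphere_borel"
    and int: "has_bochner_integral lborel (\<lambda>y. indicator (cball 0 1 - {0}) y *\<^sub>R f (sgn y)) b"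
  shows "has_bochner_integral sphere_measure f (real DIM('a) *\<^sub>R b)"
proof -
  have "has_bochner_integral (restrict_space lborel (cball 0 1 - {0})) (\<lambda>y. f (sgn y)) b"
    using int punctured_ball_borel by (subst has_bochner_integral_restrict_space) auto
  then have "has_bochner_integral (restrict_space lborel (cball 0 1 - {0}))
      (\<lambda>y. real DIM('a) *\<^sub>R f (sgn y)) (real DIM('a) *\<^sub>R b)"
    by (rule has_bochner_integral_scaleR_right)
  then have "has_bochner_integral (distr (restrict_space lborel (cball 0 1 - {0})) sphere_borel sgn)
      (\<lambda>u. real DIM('a) *\<^sub>R f u) (real DIM('a) *\<^sub>R b)"
    using f by (intro has_bochner_integral_distr sgn_measurable_punctured_ball) auto
  then show ?thesis
    using f unfolding sphere_measure_eq_density_distr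
    by (intro has_bochner_integral_density) auto
qed

section \<open>Orthogonal invariance of surface measure\<close>

lemma orthogonal_transformation_borel:
  fixes f :: "'a::euclidean_space \<Rightarrow> 'a"
  shows "orthogonal_transformation f \<Longrightarrow> f \<in> borel_measurable borel"
  by (simp add: borel_measurable_continuous_onI linear_continuous_on orthogonal_transformation_linear
      flip: linear_conv_bounded_linear)

lemma orthogonal_transformation_sphere:
  fixes f :: "'a::euclidean_space \<Rightarrow> 'a"
  assumes "orthogonal_transformation f"
  shows "f \<in> measurable sphere_measure sphere_measure"
proof -
  have "f \<in> measurable sphere_borel sphere_borel"
    using assms orthogonal_transformation_borel[OF assms]
    by (intro measurable_restrict_space3) (auto simp: orthogonal_transformation_norm)
  then show ?thesis
    by (simp cong: measurable_cong_sets)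
qed

text \<open>An orthogonal map commutes with \<open>sgn\<close> and preserves norms, so pulling back
  a set on the sphere pulls back the cone over it; Lebesgue measure is invariant.\<close>

lemma distr_sphere_measure_orthogonal:
  fixes f :: "real^'n \<Rightarrow> real^'n"
  assumes f: "orthogonal_transformation f"
  shows "distr sphere_measure sphere_measure f = sphere_measure"
proof (rule measure_eqI)
  note [measurable] = orthogonal_transformation_borel[OF f] orthogonal_transformation_sphere[OF f]
  fix A assume "A \<in> sets (distr sphere_measure sphere_measure f)"
  then have A: "A \<in> sets sphere_borel" "A \<in> sets sphere_measure"
    by simp_all
  have "f -` A \<inter> sphere 0 1 \<in> sets sphere_borel"
    using measurable_sets[OF orthogonal_transformation_sphere[OF f] A(2)] by simp
  then have "emeasure (distr sphere_measure sphere_measure f) A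
      = ennreal CARD('n) * emeasure lborel (sgn -` (f -` A \<inter> sphere 0 1) \<inter> (cball 0 1 - {0}))"
    using A by (simp add: emeasure_distr emeasure_sphere_measure)
  also have "sgn -` (f -` A \<inter> sphere 0 1) \<inter> (cball 0 1 - {0}) = f -` (sgn -` A \<inter> (cball 0 1 - {0}))"
  proof -
    have "norm (f y) = norm y" "sgn (f y) = f (sgn y)" for y
      using f by (simp_all add: orthogonal_transformation_norm sgn_div_norm
          linear_scale[OF orthogonal_transformation_linear])
    moreover from this have "f y = 0 \<longleftrightarrow> y = 0" for y
      by (metis norm_eq_zero)
    ultimately show ?thesis
      by (auto simp: norm_sgn)
  qed
  also have "emeasure lborel (f -` (sgn -` A \<inter> (cball 0 1 - {0})))
      = emeasure (distr lborel borel f) (sgn -` A \<inter> (cball 0 1 - {0}))"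
  proof -
    have "sgn -` A \<inter> space (restrict_space lborel (cball 0 1 - {0}))
        \<in> sets (restrict_space lborel (cball 0 1 - {0}))"
      by (rule measurable_sets[OF sgn_measurable_punctured_ball A(1)])
    then have "sgn -` A \<inter> (cball 0 1 - {0}) \<in> sets borel"
      using punctured_ball_borel by (auto simp: space_restrict_space sets_restrict_space_iff)
    then show ?thesis
      by (simp add: emeasure_distr)
  qed
  finally show "emeasure (distr sphere_measure sphere_measure f) A = emeasure sphere_measure A"
    using A by (simp add: distr_lborel_orthogonal[OF f] emeasure_sphere_measure)
qed simp

section \<open>Moments\<close>

lemma measurable_sphere_measure_cong:
  "borel_measurable (sphere_measure :: 'a::euclidean_space measure) = borel_measurable sphere_borel"
  by (rule measurable_cong_sets) simp_all

lemma sphere_shell_integral: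
  fixes x :: "real^'n"
  assumes x: "norm x < 1"
  shows "has_bochner_integral sphere_measure
    (\<lambda>u. inverse (norm (u - x)) ^ CARD('n) *\<^sub>R (u - x)) 0"
proof -
  have "(\<lambda>u. inverse (norm (u - x)) ^ CARD('n) *\<^sub>R (u - x)) \<in> borel_measurable borel"
    by measurable
  then have "(\<lambda>u. inverse (norm (u - x)) ^ CARD('n) *\<^sub>R (u - x)) \<in> borel_measurable sphere_borel"
    by (rule measurable_restrict_space1)
  from has_bochner_integral_sphere_measure[OF this has_bochner_integral_shell_ball[OF x]]
  show ?thesis
    by simp
qed

section \<open>The density and the symmetries of the joint law\<close>

lemma orthogonal_matrix_transformation:
  fixes Q :: "real^'n^'n"
  shows "orthogonal_matrix Q \<Longrightarrow> orthogonal_transformation ((*v) Q)"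
  by (simp add: orthogonal_transformation_matrix)

lemma orthogonal_matrix_norm:
  fixes Q :: "real^'n^'n"
  shows "orthogonal_matrix Q \<Longrightarrow> norm (Q *v v) = norm v"
  by (rule orthogonal_transformation_norm[OF orthogonal_matrix_transformation])

text \<open>For unit vectors the base of the power is the squared distance from \<open>u\<close> to
  \<open>\<rho> *\<^sub>R (Q *v v)\<close>. It is positive because \<open>\<rho> < 1\<close>, so the
  real power becomes a natural power of the distance.\<close>

lemma jw_density_shell:
  fixes Q :: "real^'n^'n"
  assumes \<rho>: "0 \<le> \<rho>" "\<rho> < 1" and Q: "orthogonal_matrix Q"
    and uv: "norm u = 1" "norm v = 1"
  shows "jw_density \<rho> Q u v = (1 - \<rho>\<^sup>2) / (sphere_area CARD('n))\<^sup>2 *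
    inverse (norm (u - \<rho> *\<^sub>R (Q *v v))) ^ CARD('n)"
proof -
  let ?x = "\<rho> *\<^sub>R (Q *v v)"
  have nQ: "norm (Q *v v) = 1"
    using Q uv by (simp add: orthogonal_matrix_norm)
  then have "norm ?x < norm u"
    using \<rho> uv by simp
  then have pos: "0 < norm (u - ?x)"
    by auto
  have "1 - 2 * \<rho> * (u \<bullet> (Q *v v)) + \<rho>\<^sup>2 = (norm (u - ?x))\<^sup>2"
    using uv nQ unfolding power2_norm_eq_inner
    by (simp add: norm_eq_1 inner_diff_left inner_diff_right inner_commute power2_eq_square)
  also have "\<dots> powr (real CARD('n) / 2) = norm (u - ?x) ^ CARD('n)"
    using pos by (simp add: powr_powr powr_realpow flip: powr_numeral)
  finally show ?thesis
    by (simp add: jw_density_def divide_simps power_inverse)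
qed

lemma pair_distr_sphere_measure_orthogonal:
  fixes f g :: "real^'n \<Rightarrow> real^'n"
  assumes "orthogonal_transformation f" "orthogonal_transformation g"
  shows "distr (sphere_measure \<Otimes>\<^sub>M sphere_measure) (sphere_measure \<Otimes>\<^sub>M sphere_measure)
    (\<lambda>(u, v). (f u, g v)) = sphere_measure \<Otimes>\<^sub>M sphere_measure"
  using pair_measure_distr[OF assms[THEN orthogonal_transformation_sphere], symmetric]
    finite_measure.axioms(1)[OF finite_sphere_measure] assms
  by (simp add: distr_sphere_measure_orthogonal)

lemma density_pair_sphere_measure_orthogonal:
  fixes f g :: "real^'n \<Rightarrow> real^'n"
  assumes f: "orthogonal_transformation f" and g: "orthogonal_transformation g"
    and c: "c \<in> borel_measurable (sphere_measure \<Otimes>\<^sub>M sphere_measure)"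
    and inv: "\<And>u v. c (f u, g v) = c (u, v)"
  shows "distr (density (sphere_measure \<Otimes>\<^sub>M sphere_measure) c) (sphere_measure \<Otimes>\<^sub>M sphere_measure)
      (\<lambda>(u, v). (f u, g v)) = density (sphere_measure \<Otimes>\<^sub>M sphere_measure) c"
proof -
  note [measurable] = orthogonal_transformation_sphere[OF f] orthogonal_transformation_sphere[OF g]
  let ?N = "sphere_measure \<Otimes>\<^sub>M sphere_measure :: ((real^'n) \<times> (real^'n)) measure"
  have h: "(\<lambda>(u, v). (f u, g v)) \<in> measurable ?N ?N"
    by measurable
  have "c \<circ> (\<lambda>(u, v). (f u, g v)) = c"
    by (auto simp: inv)
  then have "density (distr ?N ?N (\<lambda>(u, v). (f u, g v))) c
      = distr (density ?N c) ?N (\<lambda>(u, v). (f u, g v))"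
    using density_distr[OF c h] by (simp add: comp_def)
  then show ?thesis
    by (simp add: pair_distr_sphere_measure_orthogonal[OF f g])
qed

lemma sphere_measure_pair_borel:
  fixes \<phi> :: "'a::euclidean_space \<times> 'b::euclidean_space \<Rightarrow> 'c::topological_space"
  assumes "\<phi> \<in> borel_measurable borel"
  shows "\<phi> \<in> borel_measurable (sphere_measure \<Otimes>\<^sub>M sphere_measure)"
proof -
  have "(\<lambda>p. (fst p, snd p)) \<in> measurable
      (sphere_measure \<Otimes>\<^sub>M sphere_measure :: ('a \<times> 'b) measure) (borel \<Otimes>\<^sub>M borel)"
    by (intro measurable_Pair measurable_compose[OF measurable_fst] measurable_compose[OF measurable_snd])
      (simp_all add: measurable_sphere_measure_cong measurable_restrict_space1)
  then show ?thesis
    using measurable_compose[of _ _ borel \<phi> borel] assms by (simp add: borel_prod)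
qed

text \<open>The density depends on \<open>u\<close> and \<open>v\<close> only through
  \<open>u \<bullet> (Q *v v)\<close>, so a pair of orthogonal maps preserving this number preserves
  the joint law.\<close>

lemma jw_expectation_invariant:
  fixes \<phi> :: "(real^'n) \<times> (real^'n) \<Rightarrow> 'b::{banach, second_countable_topology}"
  assumes dist: "distributed M (sphere_measure \<Otimes>\<^sub>M sphere_measure) (\<lambda>\<omega>. (U \<omega>, V \<omega>))
      (\<lambda>(u, v). ennreal (jw_density \<rho> Q u v))"
    and f: "orthogonal_transformation f" and g: "orthogonal_transformation g"
    and inv: "\<And>u v. f u \<bullet> (Q *v g v) = u \<bullet> (Q *v v)"
    and \<phi>: "\<phi> \<in> borel_measurable borel"
  shows "(\<integral>\<omega>. \<phi> (f (U \<omega>), g (V \<omega>)) \<partial>M) = (\<integral>\<omega>. \<phi> (U \<omega>, V \<omega>) \<partial>M)"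
proof -
  let ?N = "sphere_measure \<Otimes>\<^sub>M sphere_measure :: ((real^'n) \<times> (real^'n)) measure"
  let ?h = "\<lambda>(u, v). (f u, g v)"
  note [measurable] = orthogonal_transformation_sphere[OF f] orthogonal_transformation_sphere[OF g]
  have h: "?h \<in> measurable ?N ?N"
    by measurable
  have UV: "(\<lambda>\<omega>. (U \<omega>, V \<omega>)) \<in> measurable M ?N"
    using dist by (rule distributed_measurable)
  have c: "(\<lambda>(u, v). ennreal (jw_density \<rho> Q u v)) \<in> borel_measurable ?N"
    using dist by (rule distributed_borel_measurable)
  have joint: "distr M ?N (\<lambda>\<omega>. (U \<omega>, V \<omega>)) = density ?N (\<lambda>(u, v). ennreal (jw_density \<rho> Q u v))"
    using dist by (rule distributed_distr_eq_density)
  have \<phi>N: "\<phi> \<in> borel_measurable ?N"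
    using \<phi> by (rule sphere_measure_pair_borel)
  have "distr (distr M ?N (\<lambda>\<omega>. (U \<omega>, V \<omega>))) ?N ?h = distr M ?N (\<lambda>\<omega>. (U \<omega>, V \<omega>))"
    unfolding joint
    by (rule density_pair_sphere_measure_orthogonal[OF f g c]) (simp add: jw_density_def inv)
  then have "distr M ?N (\<lambda>\<omega>. (f (U \<omega>), g (V \<omega>))) = distr M ?N (\<lambda>\<omega>. (U \<omega>, V \<omega>))"
    using distr_distr[OF h UV] by (simp add: comp_def)
  moreover have "(\<lambda>\<omega>. (f (U \<omega>), g (V \<omega>))) \<in> measurable M ?N"
    using measurable_comp[OF UV h] by (simp add: comp_def)
  ultimately show ?thesis
    using integral_distr[OF UV \<phi>N] integral_distr[OF _ \<phi>N, of "\<lambda>\<omega>. (f (U \<omega>), g (V \<omega>))" M] by simp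
qed

section \<open>Isotropy and second moments\<close>

lemma integral_vec_nth:
  fixes f :: "'w \<Rightarrow> real^'n"
  assumes "integrable M f"
  shows "(\<integral>\<omega>. f \<omega> \<partial>M) $ i = (\<integral>\<omega>. f \<omega> $ i \<partial>M)"
  by (rule integral_bounded_linear[OF bounded_linear_vec_nth assms, symmetric])

lemma flip_coordinate_orthogonal:
  "orthogonal_transformation (\<lambda>x :: real^'n. \<chi> k. if k = i then - x $ k else x $ k)"
  by (auto simp: orthogonal_transformation_def inner_vec_def vec_eq_iff intro!: linearI sum.cong)

lemma swap_coordinates_orthogonal:
  "orthogonal_transformation (\<lambda>x :: real^'n. \<chi> k. x $ Transposition.transpose i j k)"
proof -
  have "bij (Transposition.transpose i j)"
    by simp
  then have "(\<Sum>k\<in>UNIV. v $ Transposition.transpose i j k * w $ Transposition.transpose i j k)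
      = (\<Sum>k\<in>UNIV. v $ k * w $ k)" for v w :: "real^'n"
    by (rule sum.reindex_bij_betw)
  then show ?thesis
    by (auto simp: orthogonal_transformation_def inner_vec_def vec_eq_iff intro!: linearI)
qed

lemma (in prob_space) integrable_component_mult:
  fixes X Y :: "'a \<Rightarrow> real^'n"
  assumes [measurable]: "X \<in> borel_measurable M" "Y \<in> borel_measurable M"
    and norm: "\<And>\<omega>. \<omega> \<in> space M \<Longrightarrow> norm (X \<omega>) = 1" "\<And>\<omega>. \<omega> \<in> space M \<Longrightarrow> norm (Y \<omega>) = 1"
  shows "integrable M (\<lambda>\<omega>. X \<omega> $ k * Y \<omega> $ l)"
proof (rule integrable_const_bound[where B = 1])
  have "\<bar>X \<omega> $ k\<bar> * \<bar>Y \<omega> $ l\<bar> \<le> 1" if "\<omega> \<in> space M" for \<omega>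
    using component_le_norm_cart[of "X \<omega>"] component_le_norm_cart[of "Y \<omega>"] norm[OF that]
    by (intro mult_le_one) auto
  then show "AE \<omega> in M. norm (X \<omega> $ k * Y \<omega> $ l) \<le> 1"
    by (intro AE_I2) (simp add: abs_mult)
  have [measurable]: "(\<lambda>x :: real^'n. x $ k) \<in> borel_measurable borel" for k
    by (simp add: borel_measurable_continuous_onI continuous_on_component)
  show "(\<lambda>\<omega>. X \<omega> $ k * Y \<omega> $ l) \<in> borel_measurable M"
    by measurable
qed

text \<open>Reflecting one coordinate forces mixed moments to vanish; swapping two makes the
  diagonal moments equal, and these sum to the expected squared norm 1.\<close>

lemma (in prob_space) isotropic_second_moments:
  fixes X :: "'a \<Rightarrow> real^'n"
  assumes X: "X \<in> borel_measurable M" and norm: "\<And>\<omega>. \<omega> \<in> space M \<Longrightarrow> norm (X \<omega>) = 1"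
    and inv: "\<And>R \<phi>. orthogonal_transformation R \<Longrightarrow> \<phi> \<in> borel_measurable borel \<Longrightarrow>
      expectation (\<lambda>\<omega>. \<phi> (R (X \<omega>))) = expectation (\<lambda>\<omega>. \<phi> (X \<omega>) :: real)"
  shows "expectation (\<lambda>\<omega>. X \<omega> $ i * X \<omega> $ j) = (if i = j then 1 / real CARD('n) else 0)"
proof -
  have [measurable]: "(\<lambda>x :: real^'n. x $ k) \<in> borel_measurable borel" for k
    by (simp add: borel_measurable_continuous_onI continuous_on_component)
  note int = integrable_component_mult[OF X X norm norm]
  show ?thesis
  proof (cases "i = j")
    case False
    then have "expectation (\<lambda>\<omega>. - (X \<omega> $ i) * X \<omega> $ j) = expectation (\<lambda>\<omega>. X \<omega> $ i * X \<omega> $ j)"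
      using inv[OF flip_coordinate_orthogonal[of i], of "\<lambda>x. x $ i * x $ j"] by simp
    with False show ?thesis
      by simp
  next
    case True
    have eq: "expectation (\<lambda>\<omega>. X \<omega> $ k * X \<omega> $ k) = expectation (\<lambda>\<omega>. X \<omega> $ i * X \<omega> $ i)" for k
      using inv[OF swap_coordinates_orthogonal[of k i], of "\<lambda>x. x $ i * x $ i"] by simp
    have "1 = expectation (\<lambda>\<omega>. X \<omega> \<bullet> X \<omega>)"
      using norm by (subst Bochner_Integration.integral_cong[OF refl, of _ _ "\<lambda>_. 1"])
        (auto simp: dot_square_norm prob_space)
    also have "\<dots> = (\<Sum>k\<in>UNIV. expectation (\<lambda>\<omega>. X \<omega> $ k * X \<omega> $ k))"
      by (simp add: inner_vec_def int)
    also have "\<dots> = real CARD('n) * expectation (\<lambda>\<omega>. X \<omega> $ i * X \<omega> $ i)"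
      by (subst eq) simp
    finally show ?thesis
      using True by (simp add: field_simps)
  qed
qed

text \<open>By Fubini it suffices to integrate over \<open>u\<close> for fixed \<open>v\<close>,
  where the integrand is a constant times a coordinate of the shell kernel at
  \<open>\<rho> *\<^sub>R (Q *v v)\<close>.\<close>

lemma jw_cross_moment:
  fixes Q :: "real^'n^'n"
  assumes \<rho>: "0 \<le> \<rho>" "\<rho> < 1" and Q: "orthogonal_matrix Q"
    and dist: "distributed M (sphere_measure \<Otimes>\<^sub>M sphere_measure) (\<lambda>\<omega>. (U \<omega>, V \<omega>))
      (\<lambda>(u, v). ennreal (jw_density \<rho> Q u v))"
  shows "(\<integral>\<omega>. (U \<omega> - \<rho> *\<^sub>R (Q *v V \<omega>)) $ i * V \<omega> $ j \<partial>M) = 0"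
proof -
  let ?S = "sphere_measure :: (real^'n) measure"
  interpret S: finite_measure ?S
    by (rule finite_sphere_measure)
  interpret P: pair_sigma_finite ?S ?S ..
  define K where "K = (1 - \<rho>\<^sup>2) / (sphere_area CARD('n))\<^sup>2"
  let ?\<phi> = "\<lambda>p :: (real^'n) \<times> (real^'n). (fst p - \<rho> *\<^sub>R (Q *v snd p)) $ i * snd p $ j"
  let ?c = "\<lambda>p. jw_density \<rho> Q (fst p) (snd p)"
  have "continuous_on UNIV ?\<phi>"
    by (intro continuous_intros
        continuous_on_compose2[OF matrix_vector_mult_linear_continuous_on[of UNIV]]) auto
  then have \<phi>: "?\<phi> \<in> borel_measurable (?S \<Otimes>\<^sub>M ?S)"
    by (intro sphere_measure_pair_borel borel_measurable_continuous_onI)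
  have "\<rho>\<^sup>2 < 1"
    using \<rho> by (simp add: power_less_one_iff abs_square_less_1)
  then have nonneg: "0 \<le> ?c p" for p
    by (simp add: jw_density_def)
  have "(\<integral>\<omega>. ?\<phi> (U \<omega>, V \<omega>) \<partial>M) = (\<integral>p. ?c p * ?\<phi> p \<partial>(?S \<Otimes>\<^sub>M ?S))"
    using distributed_integral[OF _ \<phi>, of M "\<lambda>\<omega>. (U \<omega>, V \<omega>)" ?c] dist nonneg
    by (simp add: case_prod_beta')
  also have "\<dots> = 0"
  \<comment> \<open>Fubini is invoked under integrability; otherwise the Bochner integral takes its
    default value 0, which is the claim.\<close>
  proof (cases "integrable (?S \<Otimes>\<^sub>M ?S) (\<lambda>p. ?c p * ?\<phi> p)")
    case True
    have "(\<integral>u. ?c (u, v) * ?\<phi> (u, v) \<partial>?S) = 0" if v: "v \<in> space ?S" for v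
    proof -
      let ?x = "\<rho> *\<^sub>R (Q *v v)"
      have "norm ?x < 1"
        using \<rho> v Q by (simp add: orthogonal_matrix_norm)
      note shell = sphere_shell_integral[OF this]
      have "(\<integral>u. ?c (u, v) * ?\<phi> (u, v) \<partial>?S)
          = (\<integral>u. K * v $ j * ((inverse (norm (u - ?x)) ^ CARD('n) *\<^sub>R (u - ?x)) $ i) \<partial>?S)"
        using v by (intro Bochner_Integration.integral_cong) (auto simp: jw_density_shell[OF \<rho> Q] K_def)
      also have "\<dots> = 0"
        using shell
        by (simp only: integral_mult_right_zero integral_vec_nth[symmetric] has_bochner_integral_iff
            zero_index mult_zero_right)
      finally show ?thesis .
    qed
    then have "(\<integral>v. \<integral>u. ?c (u, v) * ?\<phi> (u, v) \<partial>?S \<partial>?S) = (\<integral>v. 0 \<partial>?S)"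
      by (intro Bochner_Integration.integral_cong refl)
    then show ?thesis
      using P.integral_snd[of "\<lambda>u v. ?c (u, v) * ?\<phi> (u, v)"] True
      by (simp add: case_prod_beta')
  qed (rule not_integrable_integral_eq)
  finally show ?thesis
    by simp
qed

section \<open>Matrix units, inverses and eigenvalues\<close>

lemma matrix_eq_sum_axis:
  fixes A :: "real^'n^'m"
  shows "A = (\<Sum>i\<in>UNIV. \<Sum>j\<in>UNIV. A $ i $ j *\<^sub>R axis i (axis j 1))"
proof -
  have "(\<Sum>i\<in>UNIV. \<Sum>j\<in>UNIV. A $ i $ j *\<^sub>R axis i (axis j 1)) $ a $ b = A $ a $ b" for a b
  proof -
    have "(\<Sum>i\<in>UNIV. \<Sum>j\<in>UNIV. A $ i $ j *\<^sub>R axis i (axis j 1)) $ a $ b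
        = (\<Sum>i\<in>UNIV. if i = a then \<Sum>j\<in>UNIV. if j = b then A $ i $ j else 0 else 0)"
      unfolding sum_component by (intro sum.cong refl) (auto simp: axis_def if_distrib[of "(*) _"] cong: if_cong)
    then show ?thesis
      by simp
  qed
  then show ?thesis
    by (simp only: vec_eq_iff simp_thms)
qed

lemma matrix_inv_unique:
  fixes A B :: "real^'n^'n"
  assumes "A ** B = mat 1" "B ** A = mat 1"
  shows "matrix_inv A = B"
proof -
  have "A ** matrix_inv A = mat 1"
    unfolding matrix_inv_def using assms by (metis (mono_tags, lifting) someI)
  then show ?thesis
    by (metis assms(2) matrix_mul_assoc matrix_mul_lid matrix_mul_rid)
qed

lemma matrix_inv_scaled_identity:
  fixes c :: real
  assumes "c \<noteq> 0"
  shows "matrix_inv (c *\<^sub>R mat 1 :: real^'n^'n) = inverse c *\<^sub>R mat 1"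
  by (rule matrix_inv_unique) (simp_all add: matrix_scalar_ac assms flip: scalar_matrix_assoc)

text \<open>Every nonzero vector is an eigenvector for \<open>c\<close>, so the set under
  \<open>Max\<close> is a singleton.\<close>

lemma largest_eigenvalue_scaled_identity:
  "largest_eigenvalue (c *\<^sub>R mat 1 :: real^'n^'n) = c"
proof -
  have "axis undefined 1 \<noteq> (0 :: real^'n)"
    by (simp add: axis_eq_0_iff)
  moreover have "(c *\<^sub>R mat 1) *v x = c *\<^sub>R x" for x :: "real^'n"
    by (simp flip: scaleR_matrix_vector_assoc)
  ultimately have "{k. \<exists>x. x \<noteq> 0 \<and> (c *\<^sub>R mat 1) *v x = k *\<^sub>R (x :: real^'n)} = {c}"
    by auto
  then show ?thesis
    by (simp add: largest_eigenvalue_def)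
qed

text \<open>The two inverses cancel both factors \<open>c\<close>, and
  \<open>Q ** transpose Q = mat 1\<close> leaves
  \<open>\<rho>\<^sup>2 *\<^sub>R mat 1\<close>.\<close>

lemma sqrt_largest_eigenvalue_scaled_orthogonal:
  fixes Q :: "real^'n^'n"
  assumes "0 \<le> \<rho>" and "orthogonal_matrix Q" and "c \<noteq> 0"
  shows "sqrt (largest_eigenvalue (matrix_inv (c *\<^sub>R mat 1) ** ((\<rho> * c) *\<^sub>R Q)
    ** matrix_inv (c *\<^sub>R mat 1) ** transpose ((\<rho> * c) *\<^sub>R Q))) = \<rho>"
proof -
  have "Q ** transpose Q = mat 1"
    using assms(2) by (simp add: orthogonal_matrix_def)
  then have "matrix_inv (c *\<^sub>R mat 1) ** ((\<rho> * c) *\<^sub>R Q)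
      ** matrix_inv (c *\<^sub>R mat 1) ** transpose ((\<rho> * c) *\<^sub>R Q) = \<rho>\<^sup>2 *\<^sub>R mat 1"
    using \<open>c \<noteq> 0\<close>
    by (simp add: matrix_inv_scaled_identity transpose_scalar matrix_scalar_ac power2_eq_square
        flip: scalar_matrix_assoc)
  then show ?thesis
    using assms(1) by (simp add: largest_eigenvalue_scaled_identity)
qed

theorem theorem2:
  fixes \<rho> :: real and Q :: "real^'n^'n" and M :: "'w measure"
    and U V :: "'w \<Rightarrow> real^'n"
  assumes "CARD('n) \<ge> 2"
    and "0 \<le> \<rho>" and "\<rho> < 1"
    and "orthogonal_matrix Q"
    and "prob_space M"
    and "distributed M (sphere_measure \<Otimes>\<^sub>M sphere_measure) (\<lambda>\<omega>. (U \<omega>, V \<omega>))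
           (\<lambda>(u, v). ennreal (jw_density \<rho> Q u v))"
  shows "(\<integral>\<omega>. U \<omega> \<partial>M) = 0 \<and> (\<integral>\<omega>. V \<omega> \<partial>M) = 0
    \<and> (\<integral>\<omega>. outer (U \<omega>) (U \<omega>) \<partial>M) = (1 / real CARD('n)) *\<^sub>R mat 1
    \<and> (\<integral>\<omega>. outer (V \<omega>) (V \<omega>) \<partial>M) = (1 / real CARD('n)) *\<^sub>R mat 1
    \<and> (\<integral>\<omega>. outer (U \<omega>) (V \<omega>) \<partial>M) = (\<rho> / real CARD('n)) *\<^sub>R Q
    \<and> sqrt (largest_eigenvalue
         (matrix_inv (cov_mat M U U) ** cov_mat M U V ** matrix_inv (cov_mat M V V)
            ** transpose (cov_mat M U V))) = \<rho>
    \<and> jw_corr M U V = \<rho>"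
proof -
  interpret prob_space M
    by fact
  let ?S = "sphere_measure :: (real^'n) measure"
  note Q = \<open>orthogonal_matrix Q\<close> and dist = assms(6)
  note oQ = orthogonal_matrix_transformation[OF Q]
    orthogonal_matrix_transformation[OF iffD2[OF orthogonal_matrix_transpose Q]]
  have QQ: "Q *v (transpose Q *v x) = x" "transpose Q *v (Q *v x) = x" for x
    using Q unfolding orthogonal_matrix_def
    by (simp_all only: matrix_vector_mul_assoc matrix_vector_mul_lid)
  have joint: "(\<lambda>\<omega>. (U \<omega>, V \<omega>)) \<in> measurable M (?S \<Otimes>\<^sub>M ?S)"
    using dist by (rule distributed_measurable)
  have "(\<lambda>\<omega>. fst (U \<omega>, V \<omega>)) \<in> measurable M ?S" "(\<lambda>\<omega>. snd (U \<omega>, V \<omega>)) \<in> measurable M ?S"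
    using joint by measurable
  then have "U \<in> measurable M sphere_borel" "V \<in> measurable M sphere_borel"
    by (simp_all cong: measurable_cong_sets)
  then have meas [measurable]: "U \<in> borel_measurable M" "V \<in> borel_measurable M"
    and nU: "\<And>\<omega>. \<omega> \<in> space M \<Longrightarrow> norm (U \<omega>) = 1"
    and nV: "\<And>\<omega>. \<omega> \<in> space M \<Longrightarrow> norm (V \<omega>) = 1"
    by (auto simp: measurable_restrict_space2_iff)
  note invariant = jw_expectation_invariant[OF dist]

  \<comment> \<open>Negating \<open>U\<close> and \<open>V\<close> together leaves
    \<open>u \<bullet> (Q *v v)\<close> unchanged, so both means equal their own negatives.\<close>
  have neg: "orthogonal_transformation (uminus :: real^'n \<Rightarrow> real^'n)"
    by (auto simp: orthogonal_transformation_def intro!: linearI)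
  have "(\<integral>\<omega>. - U \<omega> \<partial>M) = (\<integral>\<omega>. U \<omega> \<partial>M)" "(\<integral>\<omega>. - V \<omega> \<partial>M) = (\<integral>\<omega>. V \<omega> \<partial>M)"
    using invariant[OF neg neg, of fst] invariant[OF neg neg, of snd]
    by (simp_all add: linear_neg[OF orthogonal_transformation_linear[OF oQ(1)]]
        borel_measurable_continuous_onI continuous_on_fst continuous_on_snd continuous_on_id)
  then have mean: "(\<integral>\<omega>. U \<omega> \<partial>M) = 0" "(\<integral>\<omega>. V \<omega> \<partial>M) = 0"
    by (simp_all add: neg_eq_iff_add_eq_0 flip: scaleR_2)

  have invU: "expectation (\<lambda>\<omega>. \<phi> (R (U \<omega>))) = expectation (\<lambda>\<omega>. \<phi> (U \<omega>))"
    if R: "orthogonal_transformation R" and \<phi>: "\<phi> \<in> borel_measurable borel"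
    for R :: "real^'n \<Rightarrow> real^'n" and \<phi> :: "real^'n \<Rightarrow> real"
  proof -
    \<comment> \<open>Conjugating \<open>R\<close> gives \<open>Q *v ?g v = R (Q *v v)\<close>, so
      \<open>R\<close> acts on both slots of the inner product and cancels.\<close>
    let ?g = "\<lambda>v. transpose Q *v R (Q *v v)"
    have g: "orthogonal_transformation ?g"
      using orthogonal_transformation_compose[OF oQ(2) orthogonal_transformation_compose[OF R oQ(1)]]
      by (simp add: o_def)
    have "(\<lambda>p :: (real^'n) \<times> (real^'n). \<phi> (fst p)) \<in> borel_measurable borel"
      using \<phi> by (intro measurable_compose[OF _ \<phi>] borel_measurable_continuous_onI continuous_intros)
    moreover have "R u \<bullet> (Q *v ?g v) = u \<bullet> (Q *v v)" for u v
      unfolding QQ using R by (simp add: orthogonal_transformation_def)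
    ultimately show ?thesis
      using invariant[OF R g, of "\<lambda>p. \<phi> (fst p)"] by simp
  qed
  have UU: "expectation (\<lambda>\<omega>. U \<omega> $ i * U \<omega> $ j) = (if i = j then 1 / real CARD('n) else 0)" for i j
    using meas(1) nU invU by (rule isotropic_second_moments)

  have invV: "expectation (\<lambda>\<omega>. \<phi> (R (V \<omega>))) = expectation (\<lambda>\<omega>. \<phi> (V \<omega>))"
    if R: "orthogonal_transformation R" and \<phi>: "\<phi> \<in> borel_measurable borel"
    for R :: "real^'n \<Rightarrow> real^'n" and \<phi> :: "real^'n \<Rightarrow> real"
  proof -
    \<comment> \<open>Now \<open>R\<close> acts on \<open>V\<close>, and the opposite conjugate on
      \<open>U\<close> compensates.\<close>
    let ?f = "\<lambda>u. Q *v R (transpose Q *v u)"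
    have f: "orthogonal_transformation ?f"
      using orthogonal_transformation_compose[OF oQ(1) orthogonal_transformation_compose[OF R oQ(2)]]
      by (simp add: o_def)
    have "?f u \<bullet> (Q *v R v) = u \<bullet> (Q *v v)" for u v
    proof -
      have "?f u \<bullet> (Q *v R v) = (transpose Q *v u) \<bullet> v"
        using R oQ(1) by (simp add: orthogonal_transformation_def)
      also have "\<dots> = (Q *v (transpose Q *v u)) \<bullet> (Q *v v)"
        using oQ(1) by (simp add: orthogonal_transformation_def)
      finally show ?thesis
        by (simp only: QQ)
    qed
    moreover have "(\<lambda>p :: (real^'n) \<times> (real^'n). \<phi> (snd p)) \<in> borel_measurable borel"
      using \<phi> by (intro measurable_compose[OF _ \<phi>] borel_measurable_continuous_onI continuous_intros)
    ultimately show ?thesis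
      using invariant[OF f R, of "\<lambda>p. \<phi> (snd p)"] by simp
  qed
  have VV: "expectation (\<lambda>\<omega>. V \<omega> $ i * V \<omega> $ j) = (if i = j then 1 / real CARD('n) else 0)" for i j
    using meas(2) nV invV by (rule isotropic_second_moments)

  note int = integrable_component_mult
  have outer: "(\<integral>\<omega>. outer (X \<omega>) (Y \<omega>) \<partial>M) = A"
    if "X \<in> borel_measurable M" "Y \<in> borel_measurable M"
      and "\<And>\<omega>. \<omega> \<in> space M \<Longrightarrow> norm (X \<omega>) = 1" "\<And>\<omega>. \<omega> \<in> space M \<Longrightarrow> norm (Y \<omega>) = 1"
      and A: "\<And>i j. expectation (\<lambda>\<omega>. X \<omega> $ i * Y \<omega> $ j) = A $ i $ j"
    for X Y :: "'w \<Rightarrow> real^'n" and A :: "real^'n^'n"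
  proof -
    \<comment> \<open>Expansion in matrix units reduces the matrix-valued integral to finitely many
      real ones.\<close>
    have "integral\<^sup>L M (\<lambda>\<omega>. outer (X \<omega>) (Y \<omega>))
        = (\<integral>\<omega>. (\<Sum>i\<in>UNIV. \<Sum>j\<in>UNIV. (X \<omega> $ i * Y \<omega> $ j) *\<^sub>R axis i (axis j 1)) \<partial>M)"
      by (subst matrix_eq_sum_axis) (simp only: outer_def vec_lambda_beta)
    also have "\<dots> = (\<Sum>i\<in>UNIV. \<Sum>j\<in>UNIV. A $ i $ j *\<^sub>R axis i (axis j 1))"
      using int[OF that(1-4)] by (simp add: A)
    also have "\<dots> = A"
      by (rule matrix_eq_sum_axis[symmetric])
    finally show ?thesis .
  qed

  have cross: "expectation (\<lambda>\<omega>. U \<omega> $ i * V \<omega> $ j) = (\<rho> / real CARD('n)) * Q $ i $ j" for i j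
  proof -
    have "(Q *v V \<omega>) $ i * V \<omega> $ j = (\<Sum>k\<in>UNIV. Q $ i $ k * (V \<omega> $ k * V \<omega> $ j))" for \<omega>
      by (simp add: matrix_vector_mult_def sum_distrib_right mult.assoc)
    then have eq: "(U \<omega> - \<rho> *\<^sub>R (Q *v V \<omega>)) $ i * V \<omega> $ j
        = U \<omega> $ i * V \<omega> $ j - \<rho> * (\<Sum>k\<in>UNIV. Q $ i $ k * (V \<omega> $ k * V \<omega> $ j))" for \<omega>
      by (simp add: left_diff_distrib mult.assoc)
    \<comment> \<open>The shell theorem replaces \<open>U\<close> by
      \<open>\<rho> *\<^sub>R (Q *v V)\<close> in the moment; the isotropic moments of
      \<open>V\<close> then select the entry \<open>Q $ i $ j\<close>.\<close>
    have "0 = expectation (\<lambda>\<omega>. (U \<omega> - \<rho> *\<^sub>R (Q *v V \<omega>)) $ i * V \<omega> $ j)"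
      using jw_cross_moment[OF assms(2,3) Q dist] by simp
    also have "\<dots> = expectation (\<lambda>\<omega>. U \<omega> $ i * V \<omega> $ j)
        - \<rho> * (\<Sum>k\<in>UNIV. Q $ i $ k * (if k = j then 1 / real CARD('n) else 0))"
      unfolding eq by (simp add: int nU nV VV)
    finally show ?thesis
      by (simp add: if_distrib sum.delta cong: if_cong)
  qed

  have "(\<integral>\<omega>. outer (U \<omega>) (U \<omega>) \<partial>M) = (1 / real CARD('n)) *\<^sub>R mat 1"
    by (intro outer) (auto simp: nU UU mat_def)
  moreover have "(\<integral>\<omega>. outer (V \<omega>) (V \<omega>) \<partial>M) = (1 / real CARD('n)) *\<^sub>R mat 1"
    by (intro outer) (auto simp: nV VV mat_def)
  moreover have "(\<integral>\<omega>. outer (U \<omega>) (V \<omega>) \<partial>M) = (\<rho> / real CARD('n)) *\<^sub>R Q"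
    by (intro outer) (auto simp: nU nV cross)
  \<comment> \<open>With zero means, each \<open>cov_mat\<close> is the plain second-moment
    matrix.\<close>
  moreover have "outer 0 0 = (0 :: real^'n^'n)"
    by (simp add: outer_def vec_eq_iff)
  ultimately show ?thesis
    using mean sqrt_largest_eigenvalue_scaled_orthogonal[OF \<open>0 \<le> \<rho>\<close> Q, of "1 / real CARD('n)"]
    by (simp add: jw_corr_def cov_mat_def)
qed

end
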